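(* The Baxter equivalence relation is a lattice congruence of the permutohedron; that is, for every $n \geq 0$, the restriction of $\equiv_{\mathrm{B}}$ to $\mathfrak{S}_n$ is a lattice congruence of the lattice $(\mathfrak{S}_n, \leq_{\mathrm{P}})$.
   Context: $A = \{a_1 < a_2 < \cdots\}$ is a totally ordered infinite alphabet and $A^*$ is the free monoid of words on $A$. The Baxter congruence $\equiv_{\mathrm{B}}$ is the smallest congruence (equivalence relation compatible with concatenation) on $A^*$ such that, for all words $u, v \in A^*$ and letters $a,b,c,d \in A$: $\; c\,u\,a d\,v\,b \equiv_{\mathrm{B}} c\,u\,d a\,v\,b$ whenever $a \leq b < c \leq d$, and $\; b\,u\,d a\,v\,c \equiv_{\mathrm{B}} b\,u\,a d\,v\,c$ whenever $a < b \leq c < d$. $\mathfrak{S}_n$ is the set of permutations of size $n$, seen as words of length $n$ without repetition on the first $n$ letters of $A$ (identified with $1,\dots,n$). The permutohedron order $\leq_{\mathrm{P}}$ on $\mathfrak{S}_n$ is the partial order in which $\sigma$ is covered by $\nu$ iff $\sigma = u\,ab\,v$ and $\nu = u\,ba\,v$ for some words $u, v$ and letters $a < b$; it is a lattice. An equivalence relation $\equiv$ on a lattice $(L,\wedge,\vee)$ is a lattice congruence if for all $x,x',y,y' \in L$, $x \equiv x'$ and $y \equiv y'$ imply $x \wedge y \equiv x' \wedge y'$ and $x \vee y \equiv x' \vee y'$. *)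

theory Defs
  imports "HOL-Algebra.Lattice" "HOL-Combinatorics.Multiset_Permutations"
begin

text \<open>
  The alphabet \<open>A = {a\<^sub>1 < a\<^sub>2 < \<dots>}\<close> is the type \<open>nat\<close>, where the number \<open>i\<close> stands for
  the letter \<open>a\<^bsub>i+1\<^esub>\<close>; so the first \<open>n\<close> letters are the elements of \<open>{..<n}\<close>.
  Words are lists of letters.
\<close>

inductive baxter :: "nat list \<Rightarrow> nat list \<Rightarrow> bool"  (infix \<open>\<equiv>\<^sub>B\<close> 50)
where
  adjacency1: "a \<le> b \<Longrightarrow> b < c \<Longrightarrow> c \<le> d \<Longrightarrow>
    [c] @ u @ [a, d] @ v @ [b] \<equiv>\<^sub>B [c] @ u @ [d, a] @ v @ [b]"
| adjacency2: "a < b \<Longrightarrow> b \<le> c \<Longrightarrow> c < d \<Longrightarrow>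
    [b] @ u @ [d, a] @ v @ [c] \<equiv>\<^sub>B [b] @ u @ [a, d] @ v @ [c]"
| refl: "w \<equiv>\<^sub>B w"
| sym: "w \<equiv>\<^sub>B w' \<Longrightarrow> w' \<equiv>\<^sub>B w"
| trans: "w \<equiv>\<^sub>B w' \<Longrightarrow> w' \<equiv>\<^sub>B w'' \<Longrightarrow> w \<equiv>\<^sub>B w''"
| append: "w \<equiv>\<^sub>B w' \<Longrightarrow> z \<equiv>\<^sub>B z' \<Longrightarrow> w @ z \<equiv>\<^sub>B w' @ z'"

definition symgroup :: "nat \<Rightarrow> nat list set"  (\<open>\<SS>\<close>)
  where "\<SS> n = permutations_of_set {..<n}"

definition permutohedron_cover :: "nat list \<Rightarrow> nat list \<Rightarrow> bool"
  where "permutohedron_cover \<sigma> \<nu> \<longleftrightarrow>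
    (\<exists>u v a b. a < b \<and> \<sigma> = u @ [a, b] @ v \<and> \<nu> = u @ [b, a] @ v)"

definition permutohedron :: "nat \<Rightarrow> nat list gorder"
  where "permutohedron n = \<lparr>carrier = \<SS> n, eq = (=), le = permutohedron_cover\<^sup>*\<^sup>*\<rparr>"

text \<open>
  Being a lattice congruence includes that the ordered set \<open>L\<close> is a lattice; without it, the
  operations \<open>\<sqinter>\<close> and \<open>\<squnion>\<close>, defined by choice, would have no meaning.
\<close>

definition lattice_congruence :: "('a, 'b) gorder_scheme \<Rightarrow> ('a \<times> 'a) set \<Rightarrow> bool"
  where "lattice_congruence L r \<longleftrightarrow>
    lattice L \<and> equiv (carrier L) r \<and>
    (\<forall>x x' y y'. (x, x') \<in> r \<and> (y, y') \<in> r \<longrightarrow>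
      (x \<sqinter>\<^bsub>L\<^esub> y, x' \<sqinter>\<^bsub>L\<^esub> y') \<in> r \<and> (x \<squnion>\<^bsub>L\<^esub> y, x' \<squnion>\<^bsub>L\<^esub> y') \<in> r)"

end

theory Submission
  imports Defs
begin

text \<open>
  On permutations, a Baxter step exchanges adjacent letters \<open>a < d\<close> that have a letter of the
  interval \<open>]a, d[\<close> both somewhere to their left and somewhere to their right. The join-irreducible
  elements of the permutohedron that such exchanges do not contract are those with inversion set
  \<open>{(x, a) | a < x \<le> d}\<close> or \<open>{(d, x) | a \<le> x < d}\<close>. A Baxter class is determined by the set of
  these elements lying below its members: descending along contractible exchanges leads to a
  permutation in which every inversion is forced by elements of this kind. Lying below both
  \<open>\<sigma>\<close> and \<open>\<nu>\<close> is the same as lying below \<open>\<sigma> \<sqinter> \<nu>\<close>, so the relation is compatible with meets.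
  Reversal of words is an anti-automorphism of the permutohedron that preserves the Baxter
  relation, which gives joins.
\<close>

section \<open>Relative positions in a word\<close>

text \<open>Recursion on the word, without positions, lets the simplifier evaluate the relation on
  concatenations. On a distinct word it is a strict linear order of the letters.\<close>

fun before :: "'a list \<Rightarrow> 'a \<Rightarrow> 'a \<Rightarrow> bool" where
  "before [] x y \<longleftrightarrow> False"
| "before (z # zs) x y \<longleftrightarrow> x = z \<and> y \<in> set zs \<or> before zs x y"

lemma before_in_set: "before xs x y \<Longrightarrow> x \<in> set xs \<and> y \<in> set xs"
  by (induction xs) auto

lemma before_append [simp]:
  "before (xs @ ys) x y \<longleftrightarrow> before xs x y \<or> before ys x y \<or> x \<in> set xs \<and> y \<in> set ys"
  by (induction xs) auto

lemma before_rev [simp]: "before (rev xs) x y \<longleftrightarrow> before xs y x"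
  by (induction xs) auto

lemma before_upt [simp]: "before [i..<j] x y \<longleftrightarrow> i \<le> x \<and> x < y \<and> y < j"
  by (induction j) auto

lemma before_irrefl: "distinct xs \<Longrightarrow> \<not> before xs x x"
  by (induction xs) auto

lemma before_asym: "distinct xs \<Longrightarrow> before xs x y \<Longrightarrow> \<not> before xs y x"
  by (induction xs) (auto dest: before_in_set)

lemma before_trans: "distinct xs \<Longrightarrow> before xs x y \<Longrightarrow> before xs y z \<Longrightarrow> before xs x z"
  by (induction xs) (auto dest: before_in_set)

lemma before_total: "x \<in> set xs \<Longrightarrow> y \<in> set xs \<Longrightarrow> x \<noteq> y \<Longrightarrow> before xs x y \<or> before xs y x"
  by (induction xs) auto

lemma before_split: "before xs x y \<Longrightarrow> \<exists>us vs ws. xs = us @ x # vs @ y # ws"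
proof (induction xs)
  case (Cons z zs)
  show ?case
  proof (cases "before zs x y")
    case True
    then obtain us vs ws where "zs = us @ x # vs @ y # ws" using Cons by blast
    then have "z # zs = (z # us) @ x # vs @ y # ws" by simp
    then show ?thesis by blast
  next
    case False
    then have "x = z" "y \<in> set zs" using Cons by auto
    then obtain vs ws where "zs = vs @ y # ws" by (meson split_list)
    then have "z # zs = [] @ x # vs @ y # ws" using \<open>x = z\<close> by simp
    then show ?thesis by blast
  qed
qed simp

text \<open>A discrete intermediate value principle: on the way from \<open>x\<close> to
  \<open>y\<close> the property \<open>P\<close> is lost between two adjacent letters. It supplies
  the adjacent pairs both for the permutohedron order and for the study of minimal words.\<close>

lemma before_adjacent:
  assumes "before xs x y" "P x" "\<not> P y"
  obtains us u v vs where "xs = us @ [u, v] @ vs" "P u" "\<not> P v"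
    "u = x \<or> before xs x u" "v = y \<or> before xs v y"
proof -
  obtain ps ms qs where xs: "xs = ps @ x # ms @ y # qs"
    using before_split[OF assms(1)] by blast
  \<comment> \<open>\<open>u\<close> is the last letter with \<open>P\<close> from \<open>x\<close>
    on and ahead of \<open>y\<close>; its successor \<open>v\<close> is the head of
    \<open>bs @ [y]\<close>, so it fails \<open>P\<close>.\<close>
  have "\<exists>z\<in>set (x # ms). P z" using assms(2) by simp
  then obtain as u bs where s: "x # ms = as @ u # bs" "P u" "\<forall>z\<in>set bs. \<not> P z"
    using split_list_last_prop[of "x # ms" P] by blast
  obtain v cs where v: "bs @ [y] = v # cs" by (cases "bs @ [y]") auto
  have "v \<in> set (bs @ [y])" using v by simp
  then have "\<not> P v" using s(3) assms(3) by auto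
  have "xs = ps @ (x # ms) @ [y] @ qs" using xs by simp
  also have "\<dots> = ps @ as @ u # (bs @ [y]) @ qs" using s(1) by simp
  finally have xs': "xs = (ps @ as) @ [u, v] @ cs @ qs" using v by simp
  have "u = x \<or> before xs x u"
  proof (cases as)
    case Nil
    then show ?thesis using s(1) by simp
  next
    case (Cons _ as')
    then have "x \<in> set as" using s(1) by simp
    then show ?thesis using xs' by simp
  qed
  moreover have "v = y \<or> before xs v y"
  proof (cases bs)
    case Nil
    then show ?thesis using v by simp
  next
    case (Cons _ bs')
    then have "y \<in> set cs" using v by auto
    then show ?thesis using xs' by simp
  qed
  ultimately show thesis using that[OF xs' \<open>P u\<close> \<open>\<not> P v\<close>] by blast
qed

text \<open>The heads agree: otherwise the head of \<open>xs\<close> would come before the head of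
  \<open>ys\<close> in \<open>xs\<close>, hence also in \<open>ys\<close>. Removing the common head
  keeps the hypotheses.\<close>

lemma before_eqI:
  assumes "distinct xs" "distinct ys" "set xs = set ys"
    and "\<And>x y. before xs x y \<Longrightarrow> before ys x y"
  shows "xs = ys"
  using assms
proof (induction xs arbitrary: ys)
  case (Cons x xs)
  obtain y zs where ys: "ys = y # zs" using Cons.prems(3) by (cases ys) auto
  have "x = y"
  proof (rule ccontr)
    assume "x \<noteq> y"
    then have "y \<in> set xs" using Cons.prems(3) ys by auto
    then have "before ys x y" using Cons.prems(4) by auto
    then have "y \<in> set zs" using ys by (auto dest: before_in_set)
    then show False using Cons.prems(2) ys by simp
  qed
  moreover have "xs = zs"
  proof (rule Cons.IH)
    show "distinct xs" "distinct zs" using Cons.prems ys by auto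
    show "set xs = set zs" using Cons.prems(1-3) ys \<open>x = y\<close> by auto
    show "before zs u v" if "before xs u v" for u v
      using Cons.prems(1) Cons.prems(4)[of u v] that ys \<open>x = y\<close> by (auto dest: before_in_set)
  qed
  ultimately show ?case using ys by simp
qed simp

text \<open>Realises an abstract strict linear order as a word, so that a permutation can be built
  from a prescribed set of inversions.\<close>

lemma strict_order_list:
  assumes "finite S"
    and "\<And>x. x \<in> S \<Longrightarrow> \<not> R x x"
    and "\<And>x y z. x \<in> S \<Longrightarrow> y \<in> S \<Longrightarrow> z \<in> S \<Longrightarrow> R x y \<Longrightarrow> R y z \<Longrightarrow> R x z"
    and "\<And>x y. x \<in> S \<Longrightarrow> y \<in> S \<Longrightarrow> x \<noteq> y \<Longrightarrow> R x y \<or> R y x"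
  shows "\<exists>xs. distinct xs \<and> set xs = S \<and> (\<forall>x\<in>S. \<forall>y\<in>S. before xs x y \<longleftrightarrow> R x y)"
  using assms
proof (induction S)
  case (insert s S)
  obtain xs where xs: "distinct xs" "set xs = S" "\<And>x y. x \<in> S \<Longrightarrow> y \<in> S \<Longrightarrow> before xs x y \<longleftrightarrow> R x y"
  proof -
    have "\<exists>xs. distinct xs \<and> set xs = S \<and> (\<forall>x\<in>S. \<forall>y\<in>S. before xs x y \<longleftrightarrow> R x y)"
      by (rule insert.IH) (use insert.prems in \<open>blast intro: insertI2\<close>)+
    then show thesis using that by blast
  qed
  \<comment> \<open>The new letter goes right after the letters that \<open>R\<close> puts below it;
    both filters keep the order of \<open>xs\<close>.\<close>
  let ?ys = "filter (\<lambda>x. R x s) xs @ s # filter (\<lambda>x. \<not> R x s) xs"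
  have bf: "before (filter Q zs) x y \<longleftrightarrow> before zs x y \<and> Q x \<and> Q y" for Q zs and x y :: 'a
    by (induction zs) (auto dest: before_in_set)
  have d: "distinct ?ys" "set ?ys = insert s S"
    using xs insert.hyps by auto
  have b: "before ?ys x y" if "x \<in> insert s S" "y \<in> insert s S" "R x y" for x y
  proof -
    have irrefl: "\<not> R x x" and asym: "\<not> R y x"
      using that insert.prems(1)[of x] insert.prems(2)[of x y x] by auto
    \<comment> \<open>The implication in the third case, an instance of transitivity, excludes that
      \<open>y\<close> lands before \<open>s\<close> and \<open>x\<close> after it.\<close>
    consider "x = s" "y \<in> S" | "x \<in> S" "y = s" | "x \<in> S" "y \<in> S" "R y s \<longrightarrow> R x s"
      using \<open>x \<in> insert s S\<close> \<open>y \<in> insert s S\<close> \<open>R x y\<close> irrefl insert.prems(2)[of x y s] by blast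
    then show ?thesis
      by cases (use that asym xs in \<open>auto simp: bf\<close>)
  qed
  have "before ?ys x y \<longleftrightarrow> R x y" if "x \<in> insert s S" "y \<in> insert s S" for x y
    using b[OF that] b[OF that(2,1)] insert.prems(3)[OF that] before_asym[OF d(1)]
      before_irrefl[OF d(1)] by metis
  then show ?case using d by blast
qed simp

section \<open>The permutohedron as inclusion of inversion sets\<close>

text \<open>Letter values with the larger one first: chains of such pairs compose relationally, so
  that joins can be described by \<open>trancl\<close>.\<close>

definition inversions :: "'a::linorder list \<Rightarrow> ('a \<times> 'a) set"
  where "inversions \<sigma> = {(y, x). x < y \<and> before \<sigma> y x}"

lemma inversions_iff [simp]: "(y, x) \<in> inversions \<sigma> \<longleftrightarrow> x < y \<and> before \<sigma> y x"
  by (simp add: inversions_def)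

lemma inversions_subsetD:
  "inversions \<sigma> \<subseteq> inversions \<nu> \<Longrightarrow> x < y \<Longrightarrow> before \<sigma> y x \<Longrightarrow> before \<nu> y x"
  by (drule subsetD[of _ _ "(y, x)"]) simp_all

lemma symgroup_iff: "\<sigma> \<in> \<SS> n \<longleftrightarrow> distinct \<sigma> \<and> set \<sigma> = {..<n}"
  by (auto simp: symgroup_def permutations_of_set_def)

lemma symgroup_distinct: "\<sigma> \<in> \<SS> n \<Longrightarrow> distinct \<sigma>"
  by (simp add: symgroup_iff)

lemma rev_symgroup [simp]: "rev \<sigma> \<in> \<SS> n \<longleftrightarrow> \<sigma> \<in> \<SS> n"
  by (simp add: symgroup_iff)

text \<open>Reversal complements the inversion set among the pairs of letters \<open>(y, x)\<close>
  with \<open>x < y\<close>. This duality exchanges joins and meets.\<close>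

lemma inversions_antimono_rev:
  assumes "\<sigma> \<in> \<SS> n" "\<nu> \<in> \<SS> n"
  shows "inversions (rev \<nu>) \<subseteq> inversions (rev \<sigma>) \<longleftrightarrow> inversions \<sigma> \<subseteq> inversions \<nu>"
proof -
  have *: "inversions (rev \<nu>) \<subseteq> inversions (rev \<sigma>)"
    if "inversions \<sigma> \<subseteq> inversions \<nu>" "\<sigma> \<in> \<SS> n" "\<nu> \<in> \<SS> n" for \<sigma> \<nu>
  proof
    fix p assume "p \<in> inversions (rev \<nu>)"
    then obtain x y where p: "p = (y, x)" "x < y" "before \<nu> x y" by (cases p) auto
    have "\<not> before \<nu> y x" by (rule before_asym[OF symgroup_distinct[OF that(3)] p(3)])
    then have "\<not> before \<sigma> y x" using inversions_subsetD[OF that(1) p(2)] by blast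
    then have "before \<sigma> x y"
      using p before_total[of x \<sigma> y] before_in_set[OF p(3)] that by (auto simp: symgroup_iff)
    then show "p \<in> inversions (rev \<sigma>)" using p by simp
  qed
  show ?thesis using *[OF _ assms] *[of "rev \<nu>" "rev \<sigma>"] assms by auto
qed

text \<open>The first inclusion carries over the pairs out of natural order; the second, read on the
  reversed words, those in natural order.\<close>

lemma inversions_antisym:
  assumes "inversions \<sigma> \<subseteq> inversions \<nu>" "inversions \<nu> \<subseteq> inversions \<sigma>"
    "\<sigma> \<in> \<SS> n" "\<nu> \<in> \<SS> n"
  shows "\<sigma> = \<nu>"
proof (rule before_eqI)
  show "distinct \<sigma>" "distinct \<nu>" "set \<sigma> = set \<nu>" using assms by (auto simp: symgroup_iff)
  fix x y assume b: "before \<sigma> x y"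
  then have "x \<noteq> y" using before_irrefl[OF symgroup_distinct[OF assms(3)]] by blast
  then consider "y < x" | "x < y" by fastforce
  then show "before \<nu> x y"
  proof cases
    case 1
    then show ?thesis using inversions_subsetD[OF assms(1) _ b] by blast
  next
    case 2
    have "inversions (rev \<sigma>) \<subseteq> inversions (rev \<nu>)"
      using inversions_antimono_rev assms by blast
    then show ?thesis using inversions_subsetD[of "rev \<sigma>" "rev \<nu>" x y] 2 b by simp
  qed
qed

lemma inversions_swap:
  assumes "distinct (u @ [a, b] @ v)" "a < b"
  shows "inversions (u @ [b, a] @ v) = insert (b, a) (inversions (u @ [a, b] @ v))"
  using assms by (auto simp: inversions_def)

lemma finite_inversions: "finite (inversions \<sigma>)"
  by (rule finite_subset[of _ "set \<sigma> \<times> set \<sigma>"]) (auto simp: inversions_def dest: before_in_set)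

lemma cover_symgroup: "permutohedron_cover \<sigma> \<nu> \<Longrightarrow> \<nu> \<in> \<SS> n \<longleftrightarrow> \<sigma> \<in> \<SS> n"
  unfolding permutohedron_cover_def symgroup_iff by (elim exE conjE) (simp add: insert_commute conj_ac)

lemma permutohedron_le_imp_inversions:
  assumes "permutohedron_cover\<^sup>*\<^sup>* \<sigma> \<nu>" "\<sigma> \<in> \<SS> n"
  shows "\<nu> \<in> \<SS> n \<and> inversions \<sigma> \<subseteq> inversions \<nu>"
  using assms
proof (induction rule: rtranclp_induct)
  case (step \<mu> \<nu>)
  then have "\<mu> \<in> \<SS> n" "inversions \<sigma> \<subseteq> inversions \<mu>" by auto
  obtain u v a b where "a < b" "\<mu> = u @ [a, b] @ v" "\<nu> = u @ [b, a] @ v"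
    using step(2) unfolding permutohedron_cover_def by blast
  then have "inversions \<mu> \<subseteq> inversions \<nu>"
    using inversions_swap[of u a b v] \<open>\<mu> \<in> \<SS> n\<close> by (auto simp: symgroup_iff)
  then show ?case
    using \<open>inversions \<sigma> \<subseteq> inversions \<mu>\<close> cover_symgroup[OF step(2)] \<open>\<mu> \<in> \<SS> n\<close> by blast
qed simp

text \<open>Induction on the number of inversions of \<open>\<nu>\<close> missing from
  \<open>\<sigma>\<close>: while the words differ, some ascent of adjacent letters in
  \<open>\<sigma>\<close> is inverted in \<open>\<nu>\<close>, and exchanging it is a covering step
  that stays below \<open>\<nu>\<close>.\<close>

lemma inversions_imp_permutohedron_le:
  assumes "inversions \<sigma> \<subseteq> inversions \<nu>" "\<sigma> \<in> \<SS> n" "\<nu> \<in> \<SS> n"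
  shows "permutohedron_cover\<^sup>*\<^sup>* \<sigma> \<nu>"
  using assms
proof (induction "card (inversions \<nu> - inversions \<sigma>)" arbitrary: \<sigma> rule: less_induct)
  case less
  show ?case
  proof (cases "\<sigma> = \<nu>")
    case False
    have d: "distinct \<sigma>" "distinct \<nu>" "set \<sigma> = set \<nu>" using less.prems by (auto simp: symgroup_iff)
    then obtain x y where xy: "before \<sigma> x y" "\<not> before \<nu> x y"
      using before_eqI False by blast
    then have "x \<noteq> y" using before_irrefl[OF d(1)] by blast
    then have "before \<nu> y x"
      using xy before_total[of x \<nu> y] d(3) before_in_set[OF xy(1)] by auto
    \<comment> \<open>Reading \<open>\<sigma>\<close> from \<open>x\<close> to \<open>y\<close>, the
      property of coming after \<open>y\<close> in \<open>\<nu>\<close> holds at \<open>x\<close>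
      and fails at \<open>y\<close>; where it is lost, \<open>\<nu>\<close> has \<open>v\<close>
      before \<open>u\<close>.\<close>
    then obtain us u v vs where
      \<sigma>: "\<sigma> = us @ [u, v] @ vs" and uv: "before \<nu> y u" "\<not> before \<nu> y v"
      by (rule before_adjacent[of \<sigma> x y "before \<nu> y", OF xy(1) _ before_irrefl[OF d(2)]])
    have "v \<in> set \<nu>" "y \<in> set \<nu>" using \<sigma> d(3) before_in_set[OF uv(1)] by auto
    then have "v = y \<or> before \<nu> v y" using uv(2) before_total[of v \<nu> y] by blast
    then have vu: "before \<nu> v u" using uv(1) before_trans[OF d(2)] by blast
    have "before \<sigma> u v" using \<sigma> by simp
    have "u < v"
    proof (rule ccontr)
      assume "\<not> u < v"
      then have "(u, v) \<in> inversions \<sigma>" using \<open>before \<sigma> u v\<close> before_irrefl[OF d(1)]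
        by (metis inversions_iff linorder_neqE_nat)
      then have "before \<nu> u v" using inversions_subsetD[OF less.prems(1)] by simp
      then show False using vu before_asym[OF d(2)] by blast
    qed
    define \<sigma>' where "\<sigma>' = us @ [v, u] @ vs"
    have inv: "inversions \<sigma>' = insert (v, u) (inversions \<sigma>)"
      using inversions_swap[of us u v vs] d(1) \<open>u < v\<close> \<sigma> by (simp add: \<sigma>'_def)
    have cover: "permutohedron_cover \<sigma> \<sigma>'"
      unfolding permutohedron_cover_def \<sigma>'_def using \<sigma> \<open>u < v\<close> by blast
    have "(v, u) \<in> inversions \<nu> - inversions \<sigma>"
      using vu \<open>u < v\<close> before_asym[OF d(1) \<open>before \<sigma> u v\<close>] by simp
    then have "card (inversions \<nu> - inversions \<sigma>') < card (inversions \<nu> - inversions \<sigma>)"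
      unfolding inv by (intro psubset_card_mono finite_Diff finite_inversions) blast
    moreover have "inversions \<sigma>' \<subseteq> inversions \<nu>"
      using less.prems(1) vu \<open>u < v\<close> by (simp add: inv)
    moreover have "\<sigma>' \<in> \<SS> n" using cover_symgroup[OF cover] less.prems by blast
    ultimately have "permutohedron_cover\<^sup>*\<^sup>* \<sigma>' \<nu>"
      using less.hyps less.prems(3) by blast
    then show ?thesis using cover by (rule converse_rtranclp_into_rtranclp[rotated])
  qed simp
qed

lemma permutohedron_carrier [simp]: "carrier (permutohedron n) = \<SS> n"
  by (simp add: permutohedron_def)

lemma permutohedron_le_iff:
  assumes "\<sigma> \<in> \<SS> n" "\<nu> \<in> \<SS> n"
  shows "\<sigma> \<sqsubseteq>\<^bsub>permutohedron n\<^esub> \<nu> \<longleftrightarrow> inversions \<sigma> \<subseteq> inversions \<nu>"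
  using permutohedron_le_imp_inversions[of \<sigma> \<nu> n] inversions_imp_permutohedron_le[of \<sigma> \<nu> n] assms
  unfolding permutohedron_def by simp blast

text \<open>
  The inversion set of the join is the transitive closure of the union: it is transitive, and
  so is its complement in \<open>{(y, x) | x < y}\<close>, which makes it the inversion set of a permutation.
\<close>

lemma symgroup_join_exists:
  assumes "\<sigma> \<in> \<SS> n" "\<nu> \<in> \<SS> n"
  shows "\<exists>\<tau>\<in>\<SS> n. inversions \<sigma> \<subseteq> inversions \<tau> \<and> inversions \<nu> \<subseteq> inversions \<tau> \<and>
    (\<forall>\<rho>\<in>\<SS> n. inversions \<sigma> \<subseteq> inversions \<rho> \<longrightarrow> inversions \<nu> \<subseteq> inversions \<rho> \<longrightarrow>
      inversions \<tau> \<subseteq> inversions \<rho>)"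
proof -
  define T where "T = (inversions \<sigma> \<union> inversions \<nu>)\<^sup>+"
  have T_trans: "(x, y) \<in> T \<Longrightarrow> (y, z) \<in> T \<Longrightarrow> (x, z) \<in> T" for x y z
    unfolding T_def by (rule trancl_trans)
  have T_step: "(c, b) \<in> T \<or> (b, a) \<in> T"
    if "(c, a) \<in> inversions \<sigma> \<union> inversions \<nu>" "a < b" "b < c" for a b c
  proof -
    \<comment> \<open>As \<open>c\<close> stands left of \<open>a\<close>, the letter
      \<open>b\<close> stands right of \<open>c\<close> or left of \<open>a\<close>.\<close>
    have *: "(c, b) \<in> inversions \<mu> \<or> (b, a) \<in> inversions \<mu>"
      if "\<mu> \<in> \<SS> n" "before \<mu> c a" for \<mu>
    proof -
      have "c \<in> set \<mu>" "a \<in> set \<mu>" using before_in_set[OF that(2)] by simp_all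
      then have "b \<in> set \<mu>" using that(1) \<open>b < c\<close> by (simp add: symgroup_iff)
      then have "before \<mu> c b \<or> before \<mu> b c"
        using before_total \<open>c \<in> set \<mu>\<close> \<open>b < c\<close> by (metis less_irrefl)
      then have "before \<mu> c b \<or> before \<mu> b a"
        using before_trans[OF symgroup_distinct[OF that(1)] _ that(2)] by blast
      then show ?thesis using \<open>a < b\<close> \<open>b < c\<close> by simp
    qed
    have "before \<sigma> c a \<or> before \<nu> c a"
      using that(1) unfolding Un_iff inversions_iff by blast
    then show ?thesis using *[OF assms(1)] *[OF assms(2)] unfolding T_def by blast
  qed
  \<comment> \<open>The splitting property passes from single pairs to chains: a letter
    \<open>b\<close> below the intermediate letter splits the last pair, one above it splits the
    earlier chain.\<close>
  have T: "a < c \<and> (\<forall>b. a < b \<longrightarrow> b < c \<longrightarrow> (c, b) \<in> T \<or> (b, a) \<in> T)" if "(c, a) \<in> T" for a c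
    using that unfolding T_def
  proof (induction rule: trancl_induct)
    case (base a)
    then show ?case using T_step[unfolded T_def] by auto
  next
    case (step a a')
    have lt: "a' < a" using step(2) by auto
    have "(c, b) \<in> (inversions \<sigma> \<union> inversions \<nu>)\<^sup>+ \<or> (b, a') \<in> (inversions \<sigma> \<union> inversions \<nu>)\<^sup>+"
      if "a' < b" "b < c" for b
    proof (cases b a rule: linorder_cases)
      case less
      then show ?thesis
        using T_step[OF step(2) that(1)] T_trans[of c a b] step(1) unfolding T_def by blast
    next
      case equal
      then show ?thesis using step(1) by blast
    next
      case greater
      then have "(c, b) \<in> (inversions \<sigma> \<union> inversions \<nu>)\<^sup>+ \<or> (b, a) \<in> (inversions \<sigma> \<union> inversions \<nu>)\<^sup>+"
        using step(3) that(2) by blast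
      then show ?thesis using trancl_into_trancl[OF _ step(2)] by blast
    qed
    then show ?case using lt step(3) by auto
  qed
  \<comment> \<open>The linear order whose inversions are to be \<open>T\<close>: a pair keeps its
    natural order unless \<open>T\<close> inverts it.\<close>
  define R where "R x y \<longleftrightarrow> (if x < y then (y, x) \<notin> T else (x, y) \<in> T)" for x y
  have T_cotrans: "(c, b) \<in> T \<or> (b, a) \<in> T" if "(c, a) \<in> T" "a < b" "b < c" for a b c
    using T that by blast
  have T_less: "a < c" if "(c, a) \<in> T" for a c
    using T that by blast
  have R_trans: "R x z" if "R x y" "R y z" for x y z
  proof (cases x y rule: linorder_cases)
    case less
    then have xy: "(y, x) \<notin> T" using that(1) by (simp add: R_def)
    show ?thesis
    proof (cases "y < z")
      case True
      then have "(z, y) \<notin> T" using that(2) by (simp add: R_def)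
      then have "(z, x) \<notin> T" using T_cotrans[OF _ less True] xy by blast
      then show ?thesis using less True by (simp add: R_def)
    next
      case False
      then have yz: "(y, z) \<in> T" using that(2) by (simp add: R_def)
      then have "x \<noteq> z" using xy by blast
      then show ?thesis
        using T_cotrans[OF yz _ less] T_trans[OF yz] xy unfolding R_def by (meson linorder_neqE)
    qed
  next
    case equal
    then show ?thesis using that by simp
  next
    case greater
    then have xy: "(x, y) \<in> T" using that(1) by (simp add: R_def)
    show ?thesis
    proof (cases "y < z")
      case True
      then have yz: "(z, y) \<notin> T" using that(2) by (simp add: R_def)
      then have "x \<noteq> z" using xy by blast
      then show ?thesis
        using T_cotrans[OF xy True] T_trans[OF _ xy] yz unfolding R_def by (meson linorder_neqE)
    next
      case False
      then have yz: "(y, z) \<in> T" using that(2) by (simp add: R_def)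
      then have "(x, z) \<in> T" using T_trans[OF xy] by blast
      then show ?thesis using T_less[of x z] by (simp add: R_def)
    qed
  qed
  obtain \<tau> where \<tau>: "distinct \<tau>" "set \<tau> = {..<n}"
    "\<And>x y. x < n \<Longrightarrow> y < n \<Longrightarrow> before \<tau> x y \<longleftrightarrow> R x y"
  proof -
    have "\<exists>xs. distinct xs \<and> set xs = {..<n} \<and> (\<forall>x\<in>{..<n}. \<forall>y\<in>{..<n}. before xs x y \<longleftrightarrow> R x y)"
    proof (rule strict_order_list)
      show "\<not> R x x" for x using T by (auto simp: R_def)
      show "R x z" if "R x y" "R y z" for x y z using R_trans that .
      show "R x y \<or> R y x" if "x \<noteq> y" for x y using that by (auto simp: R_def)
    qed simp
    then show thesis using that by auto
  qed
  have T_bound: "x < n \<and> y < n" if "(x, y) \<in> T" for x y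
    using that unfolding T_def
    by (induction rule: trancl_induct) (use assms in \<open>auto simp: symgroup_iff dest!: before_in_set\<close>)
  have inv: "inversions \<tau> = T"
    unfolding set_eq_iff split_paired_All
  proof (intro allI)
    fix y x
    show "(y, x) \<in> inversions \<tau> \<longleftrightarrow> (y, x) \<in> T"
    proof (cases "x < y \<and> y < n")
      case True
      then show ?thesis using \<tau>(3)[of y x] by (simp add: R_def)
    next
      case False
      then show ?thesis
        using T_less[of y x] T_bound[of y x] before_in_set[of \<tau> y x] \<tau>(2) by auto
    qed
  qed
  have "T \<subseteq> inversions \<rho>"
    if "\<rho> \<in> \<SS> n" "inversions \<sigma> \<subseteq> inversions \<rho>" "inversions \<nu> \<subseteq> inversions \<rho>" for \<rho>
  proof -
    have "trans (inversions \<rho>)"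
      using before_trans[OF symgroup_distinct[OF that(1)]]
      by (auto intro!: transI elim: order.strict_trans)
    then have "(inversions \<rho>)\<^sup>+ = inversions \<rho>" by (rule trancl_id)
    moreover have "T \<subseteq> (inversions \<rho>)\<^sup>+"
      using that unfolding T_def by (intro trancl_mono_subset) auto
    ultimately show ?thesis by simp
  qed
  moreover have "inversions \<sigma> \<subseteq> T" "inversions \<nu> \<subseteq> T" unfolding T_def by auto
  moreover have "\<tau> \<in> \<SS> n" using \<tau> by (simp add: symgroup_iff)
  ultimately show ?thesis using inv by blast
qed

section \<open>Meets by duality, and the lattice property\<close>

lemma symgroup_meet_exists:
  assumes "\<sigma> \<in> \<SS> n" "\<nu> \<in> \<SS> n"
  shows "\<exists>\<tau>\<in>\<SS> n. inversions \<tau> \<subseteq> inversions \<sigma> \<and> inversions \<tau> \<subseteq> inversions \<nu> \<and>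
    (\<forall>\<rho>\<in>\<SS> n. inversions \<rho> \<subseteq> inversions \<sigma> \<longrightarrow> inversions \<rho> \<subseteq> inversions \<nu> \<longrightarrow>
      inversions \<rho> \<subseteq> inversions \<tau>)"
proof -
  \<comment> \<open>The meet is the reversed join of the reversed words.\<close>
  obtain \<tau> where \<tau>: "\<tau> \<in> \<SS> n" "inversions (rev \<sigma>) \<subseteq> inversions \<tau>"
    "inversions (rev \<nu>) \<subseteq> inversions \<tau>"
    "\<And>\<rho>. \<rho> \<in> \<SS> n \<Longrightarrow> inversions (rev \<sigma>) \<subseteq> inversions \<rho> \<Longrightarrow> inversions (rev \<nu>) \<subseteq> inversions \<rho> \<Longrightarrow>
      inversions \<tau> \<subseteq> inversions \<rho>"
    using symgroup_join_exists[of "rev \<sigma>" n "rev \<nu>"] assms by auto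
  have anti: "inversions (rev \<mu>) \<subseteq> inversions \<rho> \<longleftrightarrow> inversions (rev \<rho>) \<subseteq> inversions \<mu>"
    if "\<mu> \<in> \<SS> n" "\<rho> \<in> \<SS> n" for \<mu> \<rho>
    using inversions_antimono_rev[of "rev \<rho>" n \<mu>] that by simp
  show ?thesis
  proof (intro bexI[of _ "rev \<tau>"] conjI ballI impI)
    show "inversions (rev \<tau>) \<subseteq> inversions \<sigma>" "inversions (rev \<tau>) \<subseteq> inversions \<nu>"
      using \<tau> assms anti by blast+
    fix \<rho> assume \<rho>: "\<rho> \<in> \<SS> n" "inversions \<rho> \<subseteq> inversions \<sigma>" "inversions \<rho> \<subseteq> inversions \<nu>"
    then have "inversions \<tau> \<subseteq> inversions (rev \<rho>)"
      using \<tau>(4)[of "rev \<rho>"] inversions_antimono_rev assms by auto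
    then show "inversions \<rho> \<subseteq> inversions (rev \<tau>)"
      using inversions_antimono_rev[of \<tau> n "rev \<rho>"] \<rho>(1) \<tau>(1) by simp
  qed (use \<tau> in simp)
qed

lemma lattice_permutohedron: "lattice (permutohedron n)"
proof -
  have eq: "eq (permutohedron n) = (=)" by (simp add: permutohedron_def)
  interpret partial_order "permutohedron n"
  proof unfold_locales
    fix \<sigma> \<nu> assume "\<sigma> \<sqsubseteq>\<^bsub>permutohedron n\<^esub> \<nu>" "\<nu> \<sqsubseteq>\<^bsub>permutohedron n\<^esub> \<sigma>"
      "\<sigma> \<in> carrier (permutohedron n)" "\<nu> \<in> carrier (permutohedron n)"
    then show "\<sigma> .=\<^bsub>permutohedron n\<^esub> \<nu>"
      using inversions_antisym by (simp add: permutohedron_le_iff eq)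
  qed (auto simp: eq permutohedron_le_iff)
  show ?thesis
  proof unfold_locales
    fix \<sigma> \<nu> assume "\<sigma> \<in> carrier (permutohedron n)" "\<nu> \<in> carrier (permutohedron n)"
    then have \<sigma>\<nu>: "\<sigma> \<in> \<SS> n" "\<nu> \<in> \<SS> n" by auto
    show "\<exists>s. least (permutohedron n) s (Upper (permutohedron n) {\<sigma>, \<nu>})"
    proof -
      obtain \<tau> where \<tau>: "\<tau> \<in> \<SS> n" "inversions \<sigma> \<subseteq> inversions \<tau>"
        "inversions \<nu> \<subseteq> inversions \<tau>"
        "\<And>\<rho>. \<rho> \<in> \<SS> n \<Longrightarrow> inversions \<sigma> \<subseteq> inversions \<rho> \<Longrightarrow> inversions \<nu> \<subseteq> inversions \<rho> \<Longrightarrow>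
          inversions \<tau> \<subseteq> inversions \<rho>"
        using symgroup_join_exists[OF \<sigma>\<nu>] by blast
      have "least (permutohedron n) \<tau> (Upper (permutohedron n) {\<sigma>, \<nu>})"
      proof (rule least_UpperI)
        fix \<rho> assume "\<rho> \<in> Upper (permutohedron n) {\<sigma>, \<nu>}"
        then have "\<rho> \<in> \<SS> n" "\<sigma> \<sqsubseteq>\<^bsub>permutohedron n\<^esub> \<rho>" "\<nu> \<sqsubseteq>\<^bsub>permutohedron n\<^esub> \<rho>"
          using \<sigma>\<nu> by (simp_all add: Upper_def)
        then show "\<tau> \<sqsubseteq>\<^bsub>permutohedron n\<^esub> \<rho>" using \<sigma>\<nu> \<tau> by (simp add: permutohedron_le_iff)
      qed (use \<sigma>\<nu> \<tau>(1-3) permutohedron_le_iff in auto)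
      then show ?thesis ..
    qed
    show "\<exists>s. greatest (permutohedron n) s (Lower (permutohedron n) {\<sigma>, \<nu>})"
    proof -
      obtain \<tau> where \<tau>: "\<tau> \<in> \<SS> n" "inversions \<tau> \<subseteq> inversions \<sigma>"
        "inversions \<tau> \<subseteq> inversions \<nu>"
        "\<And>\<rho>. \<rho> \<in> \<SS> n \<Longrightarrow> inversions \<rho> \<subseteq> inversions \<sigma> \<Longrightarrow> inversions \<rho> \<subseteq> inversions \<nu> \<Longrightarrow>
          inversions \<rho> \<subseteq> inversions \<tau>"
        using symgroup_meet_exists[OF \<sigma>\<nu>] by blast
      have "greatest (permutohedron n) \<tau> (Lower (permutohedron n) {\<sigma>, \<nu>})"
      proof (rule greatest_LowerI)
        fix \<rho> assume "\<rho> \<in> Lower (permutohedron n) {\<sigma>, \<nu>}"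
        then have "\<rho> \<in> \<SS> n" "\<rho> \<sqsubseteq>\<^bsub>permutohedron n\<^esub> \<sigma>" "\<rho> \<sqsubseteq>\<^bsub>permutohedron n\<^esub> \<nu>"
          using \<sigma>\<nu> by (simp_all add: Lower_def)
        then show "\<rho> \<sqsubseteq>\<^bsub>permutohedron n\<^esub> \<tau>" using \<sigma>\<nu> \<tau> by (simp add: permutohedron_le_iff)
      qed (use \<sigma>\<nu> \<tau>(1-3) permutohedron_le_iff in auto)
      then show ?thesis ..
    qed
  qed
qed

section \<open>The Baxter classes\<close>

text \<open>
  The two families of uncontracted join-irreducible elements, in the form of the conditions
  that they lie below \<open>\<sigma>\<close>.
\<close>

definition up_block :: "nat list \<Rightarrow> nat \<Rightarrow> nat \<Rightarrow> bool"
  where "up_block \<sigma> a d \<longleftrightarrow> (\<forall>x\<in>{a<..d}. before \<sigma> x a)"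

definition down_block :: "nat list \<Rightarrow> nat \<Rightarrow> nat \<Rightarrow> bool"
  where "down_block \<sigma> a d \<longleftrightarrow> (\<forall>x\<in>{a..<d}. before \<sigma> d x)"

text \<open>The indices range over all letters. A pair with \<open>d \<le> a\<close> satisfies both
  conditions vacuously for every word, so it never separates two words.\<close>

definition blocks :: "nat list \<Rightarrow> (nat \<times> nat) set \<times> (nat \<times> nat) set"
  where "blocks \<sigma> = ({(a, d). up_block \<sigma> a d}, {(a, d). down_block \<sigma> a d})"

lemma blocks_eq_iff:
  "blocks \<sigma> = blocks \<nu> \<longleftrightarrow>
    (\<forall>a d. (up_block \<sigma> a d \<longleftrightarrow> up_block \<nu> a d) \<and> (down_block \<sigma> a d \<longleftrightarrow> down_block \<nu> a d))"
  by (auto simp: blocks_def set_eq_iff)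

section \<open>Invariance of the blocks under the Baxter congruence\<close>

lemma baxter_mset: "w \<equiv>\<^sub>B w' \<Longrightarrow> mset w = mset w'"
  by (induction rule: baxter.induct) auto

lemma baxter_distinct: "w \<equiv>\<^sub>B w' \<Longrightarrow> distinct w \<longleftrightarrow> distinct w'"
  using baxter_mset mset_eq_imp_distinct_iff by blast

text \<open>Only the order of \<open>a\<close> and \<open>d\<close> changes. It enters only into
  \<open>up_block\<close> at \<open>a\<close> with upper end at least \<open>d\<close>, which fails
  in both words because \<open>y\<close> stands right of \<open>a\<close>, and into
  \<open>down_block\<close> at \<open>d\<close> with lower end at most \<open>a\<close>, which fails
  because \<open>x\<close> stands left of \<open>d\<close>.\<close>

lemma blocks_swap:
  assumes "distinct (p @ [a, d] @ q)" "x \<in> set p" "y \<in> set q" "a < x" "x < d" "a < y" "y < d"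
  shows "blocks (p @ [a, d] @ q) = blocks (p @ [d, a] @ q)"
proof -
  have b: "before (p @ [a, d] @ q) s t \<longleftrightarrow> before (p @ [d, a] @ q) s t"
    if "(s, t) \<noteq> (a, d)" "(s, t) \<noteq> (d, a)" for s t
    using that by auto
  have ny: "\<not> before (p @ [a, d] @ q) y a" "\<not> before (p @ [d, a] @ q) y a"
    and nx: "\<not> before (p @ [a, d] @ q) d x" "\<not> before (p @ [d, a] @ q) d x"
    using assms by (auto dest: before_in_set)
  have "up_block (p @ [a, d] @ q) s t \<longleftrightarrow> up_block (p @ [d, a] @ q) s t" for s t
  proof (cases "s = a \<and> d \<le> t")
    case True
    then have "y \<in> {s<..t}" using assms by auto
    then show ?thesis unfolding up_block_def using ny True by blast
  next
    case False
    then have "before (p @ [a, d] @ q) x s \<longleftrightarrow> before (p @ [d, a] @ q) x s" if "x \<in> {s<..t}" for x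
      using that assms(4,5) by (intro b) auto
    then show ?thesis unfolding up_block_def by blast
  qed
  moreover have "down_block (p @ [a, d] @ q) s t \<longleftrightarrow> down_block (p @ [d, a] @ q) s t" for s t
  proof (cases "t = d \<and> s \<le> a")
    case True
    then have "x \<in> {s..<t}" using assms by auto
    then show ?thesis unfolding down_block_def using nx True by blast
  next
    case False
    then have "before (p @ [a, d] @ q) t x \<longleftrightarrow> before (p @ [d, a] @ q) t x" if "x \<in> {s..<t}" for x
      using that assms(4,5) by (intro b) auto
    then show ?thesis unfolding down_block_def by blast
  qed
  ultimately show ?thesis by (simp add: blocks_eq_iff)
qed

text \<open>
  The context \<open>p\<close>, \<open>q\<close> is needed for the induction, since the blocks of a concatenation are not
  determined by the blocks of its factors.
\<close>

lemma baxter_blocks_context: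
  assumes "w \<equiv>\<^sub>B w'" "distinct (p @ w @ q)"
  shows "blocks (p @ w @ q) = blocks (p @ w' @ q)"
  using assms
proof (induction arbitrary: p q rule: baxter.induct)
  \<comment> \<open>Distinctness of the word sharpens the weak inequalities of the rule to the
    strict ones that \<open>blocks_swap\<close> asks for.\<close>
  case (adjacency1 a b c d u v)
  then show ?case
    using blocks_swap[of "p @ [c] @ u" a d "v @ [b] @ q" c b] by (auto simp: less_le)
next
  case (adjacency2 a b c d u v)
  then show ?case
    using blocks_swap[of "p @ [b] @ u" a d "v @ [c] @ q" b c] by (auto simp: less_le)
next
  case (sym w w')
  have "mset (p @ w @ q) = mset (p @ w' @ q)" using baxter_mset[OF sym(1)] by simp
  then have "distinct (p @ w @ q)" using sym.prems mset_eq_imp_distinct_iff by blast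
  then show ?case using sym.IH by simp
next
  case (trans w w' w'')
  have "mset (p @ w @ q) = mset (p @ w' @ q)" using baxter_mset[OF trans(1)] by simp
  then have "distinct (p @ w' @ q)" using trans.prems mset_eq_imp_distinct_iff by blast
  then show ?case using trans by simp
next
  case (append w w' z z')
  have "mset (p @ w @ z @ q) = mset (p @ w' @ z @ q)" using baxter_mset[OF append(1)] by simp
  then have "distinct (p @ w' @ z @ q)" using append.prems mset_eq_imp_distinct_iff by (metis append_assoc)
  then show ?case using append.IH(1)[of p "z @ q"] append.IH(2)[of "p @ w'" q] append.prems by simp
qed simp

lemma baxter_blocks: "w \<equiv>\<^sub>B w' \<Longrightarrow> distinct w \<Longrightarrow> blocks w = blocks w'"
  using baxter_blocks_context[of w w' "[]" "[]"] by simp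

text \<open>The two adjacency rules differ in which witness is the smaller one, the left or the
  right; together they allow any pair of distinct witnesses.\<close>

lemma baxter_swap:
  assumes "x \<in> set p" "y \<in> set q" "x \<noteq> y" "a < x" "x < d" "a < y" "y < d"
  shows "p @ [d, a] @ q \<equiv>\<^sub>B p @ [a, d] @ q"
proof -
  obtain p1 p2 q1 q2 where pq: "p = p1 @ x # p2" "q = q1 @ y # q2"
    using assms(1,2) by (meson split_list)
  have "[x] @ p2 @ [d, a] @ q1 @ [y] \<equiv>\<^sub>B [x] @ p2 @ [a, d] @ q1 @ [y]"
  proof (cases "x < y")
    case True
    then show ?thesis using assms by (intro baxter.adjacency2) auto
  next
    case False
    then show ?thesis using assms by (intro baxter.sym[OF baxter.adjacency1]) auto
  qed
  then have "p1 @ ([x] @ p2 @ [d, a] @ q1 @ [y]) @ q2 \<equiv>\<^sub>B p1 @ ([x] @ p2 @ [a, d] @ q1 @ [y]) @ q2"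
    by (rule baxter.append[OF baxter.refl baxter.append[OF _ baxter.refl]])
  then show ?thesis by (simp add: pq)
qed

section \<open>Minimal representatives of the Baxter classes\<close>

definition contractible_descent :: "nat list \<Rightarrow> bool"
  where "contractible_descent \<sigma> \<longleftrightarrow> (\<exists>p d a q. \<sigma> = p @ [d, a] @ q \<and>
    (\<exists>x\<in>set p. a < x \<and> x < d) \<and> (\<exists>y\<in>set q. a < y \<and> y < d))"

text \<open>Undoing a contractible descent stays in the class and removes exactly one inversion, so
  the process ends.\<close>

lemma baxter_minimal_exists:
  assumes "\<sigma> \<in> \<SS> n"
  shows "\<exists>\<mu>\<in>\<SS> n. \<sigma> \<equiv>\<^sub>B \<mu> \<and> \<not> contractible_descent \<mu>"
  using assms
proof (induction "card (inversions \<sigma>)" arbitrary: \<sigma> rule: less_induct)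
  case less
  show ?case
  proof (cases "contractible_descent \<sigma>")
    case True
    then obtain p d a q x y where \<sigma>: "\<sigma> = p @ [d, a] @ q"
      and xy: "x \<in> set p" "a < x" "x < d" "y \<in> set q" "a < y" "y < d"
      unfolding contractible_descent_def by blast
    have dist: "distinct \<sigma>" using less.prems by (simp add: symgroup_iff)
    let ?\<sigma> = "p @ [a, d] @ q"
    have dist': "distinct ?\<sigma>" using dist \<sigma> by auto
    have "(d, a) \<notin> inversions ?\<sigma>" using before_asym[OF dist', of a d] by simp
    moreover have "inversions \<sigma> = insert (d, a) (inversions ?\<sigma>)"
      using inversions_swap[OF dist'] xy \<sigma> by simp
    ultimately have "card (inversions ?\<sigma>) < card (inversions \<sigma>)"
      using finite_inversions[of ?\<sigma>] by simp
    moreover have "?\<sigma> \<in> \<SS> n" using less.prems \<sigma> by (auto simp: symgroup_iff)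
    ultimately obtain \<mu> where \<mu>: "\<mu> \<in> \<SS> n" "?\<sigma> \<equiv>\<^sub>B \<mu>" "\<not> contractible_descent \<mu>"
      using less.hyps by blast
    have "\<sigma> \<equiv>\<^sub>B ?\<sigma>" unfolding \<sigma> using xy dist \<sigma> by (intro baxter_swap[of x _ y]) auto
    then show ?thesis using \<mu> baxter.trans by blast
  next
    case False
    then show ?thesis using less.prems baxter.refl by blast
  qed
qed

text \<open>
  If \<open>d\<close> precedes \<open>a < d\<close> and no letter between them in position lies between them in value, then
  some adjacent descent \<open>d' a'\<close> with \<open>a' \<le> a\<close> and \<open>d \<le> d'\<close> occurs on the way from \<open>d\<close> to \<open>a\<close>. As it
  is not contractible, \<open>a' = a\<close> or \<open>d' = d\<close>, and the inversion is part of a block.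
\<close>

lemma minimal_inversions_subset:
  assumes "\<sigma> \<in> \<SS> n" "\<nu> \<in> \<SS> n" "\<not> contractible_descent \<sigma>" "blocks \<sigma> = blocks \<nu>"
  shows "inversions \<sigma> \<subseteq> inversions \<nu>"
proof -
  have dist: "distinct \<sigma>" "distinct \<nu>" and sets: "set \<sigma> = {..<n}" using assms by (auto simp: symgroup_iff)
  have "before \<nu> d a" if "a < d" "before \<sigma> d a" for a d
    using that
  proof (induction "d - a" arbitrary: a d rule: less_induct)
    case less
    show ?case
    \<comment> \<open>A letter between \<open>a\<close> and \<open>d\<close> both in value and in
      position splits the inversion into two with smaller difference.\<close>
    proof (cases "\<exists>w. a < w \<and> w < d \<and> before \<sigma> d w \<and> before \<sigma> w a")
      case True
      then obtain w where w: "a < w" "w < d" "before \<sigma> d w" "before \<sigma> w a" by blast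
      have "before \<nu> d w" using less.hyps[OF _ w(2,3)] w(1,2) by simp
      moreover have "before \<nu> w a" using less.hyps[OF _ w(1,4)] w(1,2) by simp
      ultimately show ?thesis by (rule before_trans[OF dist(2)])
    next
      case False
      \<comment> \<open>On the way from \<open>d\<close> to \<open>a\<close> the letters drop from
        at least \<open>d\<close> to below \<open>d\<close>; the drop happens at an adjacent
        descent.\<close>
      obtain p d' a' q where \<sigma>: "\<sigma> = p @ [d', a'] @ q" and "d \<le> d'" "\<not> d \<le> a'"
        and d': "d' = d \<or> before \<sigma> d d'" and a': "a' = a \<or> before \<sigma> a' a"
        by (rule before_adjacent[OF less.prems(2), of "\<lambda>w. d \<le> w"]) (use less.prems(1) in simp_all)
      have "before \<sigma> d a'" using d' before_trans[OF dist(1), of d d' a'] \<sigma> by auto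
      \<comment> \<open>Otherwise \<open>a'\<close> would lie between \<open>a\<close> and
        \<open>d\<close> both in value and in position.\<close>
      then have "a' \<le> a" using False a' \<open>\<not> d \<le> a'\<close> by force
      \<comment> \<open>The letters strictly between \<open>a'\<close> and \<open>d'\<close> in
        value must all stand on the same side of the descent.\<close>
      have "\<not> ((\<exists>x\<in>set p. a' < x \<and> x < d') \<and> (\<exists>y\<in>set q. a' < y \<and> y < d'))"
        using assms(3) \<sigma> unfolding contractible_descent_def by blast
      moreover have "x \<in> set p \<or> x \<in> set q" if "a' < x" "x < d'" for x
      proof -
        have "d' \<in> set \<sigma>" using \<sigma> by simp
        then have "x \<in> set \<sigma>" using that sets by auto
        then show ?thesis using that \<sigma> by auto
      qed
      ultimately consider "\<And>x. a' < x \<Longrightarrow> x < d' \<Longrightarrow> x \<in> set p" | "\<And>x. a' < x \<Longrightarrow> x < d' \<Longrightarrow> x \<in> set q"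
        by blast
      then show ?thesis
      proof cases
        case 1
        \<comment> \<open>Otherwise \<open>a\<close> would be one of the letters in
          \<open>p\<close>, hence left of \<open>a'\<close>, although it comes after
          \<open>a'\<close>.\<close>
        have "a' = a"
        proof (rule ccontr)
          assume "a' \<noteq> a"
          then have "a \<in> set p" "before \<sigma> a' a" using 1 \<open>a' \<le> a\<close> a' less.prems(1) \<open>d \<le> d'\<close> by auto
          then have "before \<sigma> a a'" using \<sigma> by simp
          then show False using before_asym[OF dist(1) \<open>before \<sigma> a' a\<close>] by blast
        qed
        then have "up_block \<sigma> a d'" unfolding up_block_def using 1 \<sigma> by (auto simp: le_less)
        then have "up_block \<nu> a d'" using assms(4) by (simp add: blocks_eq_iff)
        then show ?thesis using less.prems(1) \<open>d \<le> d'\<close> by (auto simp: up_block_def)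
      next
        case 2
        have "d' = d"
        proof (rule ccontr)
          assume "d' \<noteq> d"
          then have "d \<in> set q" "before \<sigma> d d'" using 2 \<open>a' \<le> a\<close> d' less.prems(1) \<open>d \<le> d'\<close> by auto
          then have "before \<sigma> d' d" using \<sigma> by simp
          then show False using before_asym[OF dist(1) \<open>before \<sigma> d d'\<close>] by blast
        qed
        then have "down_block \<sigma> a' d" unfolding down_block_def using 2 \<sigma> by (auto simp: le_less)
        then have "down_block \<nu> a' d" using assms(4) by (simp add: blocks_eq_iff)
        then show ?thesis using less.prems(1) \<open>a' \<le> a\<close> by (auto simp: down_block_def)
      qed
    qed
  qed
  then show ?thesis unfolding inversions_def by blast
qed

text \<open>Blocks are a complete invariant: minimal representatives with equal blocks include each
  other's inversions by \<open>minimal_inversions_subset\<close> in both directions, so they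
  coincide.\<close>

lemma baxter_iff_blocks:
  assumes "\<sigma> \<in> \<SS> n" "\<nu> \<in> \<SS> n"
  shows "\<sigma> \<equiv>\<^sub>B \<nu> \<longleftrightarrow> blocks \<sigma> = blocks \<nu>"
proof
  show "\<sigma> \<equiv>\<^sub>B \<nu> \<Longrightarrow> blocks \<sigma> = blocks \<nu>" using baxter_blocks assms by (simp add: symgroup_iff)
  assume eq: "blocks \<sigma> = blocks \<nu>"
  obtain \<sigma>' \<nu>' where 1: "\<sigma>' \<in> \<SS> n" "\<sigma> \<equiv>\<^sub>B \<sigma>'" "\<not> contractible_descent \<sigma>'"
    and 2: "\<nu>' \<in> \<SS> n" "\<nu> \<equiv>\<^sub>B \<nu>'" "\<not> contractible_descent \<nu>'"
    using baxter_minimal_exists assms by metis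
  have "blocks \<sigma>' = blocks \<nu>'"
    using eq baxter_blocks[OF 1(2)] baxter_blocks[OF 2(2)] assms by (simp add: symgroup_iff)
  then have "\<sigma>' = \<nu>'"
    using minimal_inversions_subset[OF 1(1) 2(1) 1(3)] minimal_inversions_subset[OF 2(1) 1(1) 2(3)]
      inversions_antisym 1(1) 2(1) by metis
  then show "\<sigma> \<equiv>\<^sub>B \<nu>" using 1(2) 2(2) baxter.sym baxter.trans by blast
qed

text \<open>
  Distinctness matters: reversal turns the weak inequalities of one adjacency rule into the
  strict ones of the other.
\<close>

lemma baxter_rev: "w \<equiv>\<^sub>B w' \<Longrightarrow> distinct w \<Longrightarrow> rev w \<equiv>\<^sub>B rev w'"
proof (induction rule: baxter.induct)
  case (adjacency1 a b c d u v)
  then show ?case using baxter.adjacency2[of a b c d "rev v" "rev u"] by (auto simp: less_le)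
next
  case (adjacency2 a b c d u v)
  then show ?case using baxter.adjacency1[of a b c d "rev v" "rev u"] by (auto simp: less_le)
next
  case (sym w w')
  then show ?case using baxter_distinct baxter.sym by blast
next
  case (trans w w' w'')
  then show ?case using baxter_distinct baxter.trans by blast
next
  case (append w w' z z')
  then show ?case using baxter.append by simp
qed (rule baxter.refl)

section \<open>Block conditions as lower bounds, and compatibility with meets\<close>

lemma up_block_iff_inversions:
  assumes "a < d" "d < n"
  obtains j where "j \<in> \<SS> n" "\<And>\<sigma>. up_block \<sigma> a d \<longleftrightarrow> inversions j \<subseteq> inversions \<sigma>"
proof
  \<comment> \<open>The identity with \<open>a\<close> moved to just after \<open>d\<close>.\<close>
  let ?j = "[0..<a] @ [Suc a..<Suc d] @ [a] @ [Suc d..<n]"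
  show "?j \<in> \<SS> n" using assms by (auto simp: symgroup_iff)
  have inv: "inversions ?j = {a<..d} \<times> {a}" using assms by (auto simp: inversions_def simp del: upt_Suc)
  show "up_block \<sigma> a d \<longleftrightarrow> inversions ?j \<subseteq> inversions \<sigma>" for \<sigma>
    unfolding inv up_block_def by (auto dest: subsetD)
qed

lemma down_block_iff_inversions:
  assumes "a < d" "d < n"
  obtains j where "j \<in> \<SS> n" "\<And>\<sigma>. down_block \<sigma> a d \<longleftrightarrow> inversions j \<subseteq> inversions \<sigma>"
proof
  \<comment> \<open>The identity with \<open>d\<close> moved to just in front of
    \<open>a\<close>.\<close>
  let ?j = "[0..<a] @ [d] @ [a..<d] @ [Suc d..<n]"
  show "?j \<in> \<SS> n" using assms by (auto simp: symgroup_iff)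
  have "(y, x) \<in> inversions ?j \<longleftrightarrow> y = d \<and> a \<le> x \<and> x < d" for x y
    using assms by (simp del: upt_Suc) arith
  then have inv: "inversions ?j = {d} \<times> {a..<d}"
    by (simp only: set_eq_iff split_paired_All mem_Times_iff fst_conv snd_conv singleton_iff
        atLeastLessThan_iff simp_thms)
  show "down_block \<sigma> a d \<longleftrightarrow> inversions ?j \<subseteq> inversions \<sigma>" for \<sigma>
    unfolding inv down_block_def by (auto dest: subsetD)
qed

text \<open>Each block condition says that a fixed permutation lies below, and lying below a
  greatest lower bound means lying below both arguments. The hypotheses speak of inversions instead
  of the lattice operation so that reversed joins fit as well as meets.\<close>

lemma blocks_cong_glb:
  assumes \<sigma>\<nu>\<mu>: "\<sigma> \<in> \<SS> n" "\<nu> \<in> \<SS> n" "\<mu> \<in> \<SS> n" "\<sigma>' \<in> \<SS> n" "\<nu>' \<in> \<SS> n" "\<mu>' \<in> \<SS> n"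
    and eq: "blocks \<sigma> = blocks \<sigma>'" "blocks \<nu> = blocks \<nu>'"
    and glb: "\<And>j. j \<in> \<SS> n \<Longrightarrow>
      inversions j \<subseteq> inversions \<mu> \<longleftrightarrow> inversions j \<subseteq> inversions \<sigma> \<and> inversions j \<subseteq> inversions \<nu>"
    and glb': "\<And>j. j \<in> \<SS> n \<Longrightarrow>
      inversions j \<subseteq> inversions \<mu>' \<longleftrightarrow> inversions j \<subseteq> inversions \<sigma>' \<and> inversions j \<subseteq> inversions \<nu>'"
  shows "blocks \<mu> = blocks \<mu>'"
proof -
  have up: "up_block \<sigma> a d \<longleftrightarrow> up_block \<sigma>' a d" "up_block \<nu> a d \<longleftrightarrow> up_block \<nu>' a d"
    and down: "down_block \<sigma> a d \<longleftrightarrow> down_block \<sigma>' a d" "down_block \<nu> a d \<longleftrightarrow> down_block \<nu>' a d" for a d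
    using eq by (simp_all add: blocks_eq_iff)
  have "(up_block \<mu> a d \<longleftrightarrow> up_block \<mu>' a d) \<and> (down_block \<mu> a d \<longleftrightarrow> down_block \<mu>' a d)" for a d
  proof -
    consider "d \<le> a" | "a < d" "n \<le> d" | "a < d" "d < n" by linarith
    then show ?thesis
    proof cases
      case 1
      then show ?thesis by (auto simp: up_block_def down_block_def)
    next
      case 2
      \<comment> \<open>Such a block would require the letter \<open>d\<close> to occur in the
        word.\<close>
      then have "\<not> up_block \<tau> a d \<and> \<not> down_block \<tau> a d" if "\<tau> \<in> \<SS> n" for \<tau>
      proof -
        have "a \<in> {a..<d}" "d \<in> {a<..d}" "d \<notin> set \<tau>" using 2 that by (auto simp: symgroup_iff)
        then show ?thesis unfolding up_block_def down_block_def using before_in_set by metis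
      qed
      then show ?thesis using \<sigma>\<nu>\<mu> by blast
    next
      case 3
      obtain j where "j \<in> \<SS> n" "\<And>\<sigma>. up_block \<sigma> a d \<longleftrightarrow> inversions j \<subseteq> inversions \<sigma>"
        using up_block_iff_inversions[OF 3] by blast
      moreover obtain k where "k \<in> \<SS> n" "\<And>\<sigma>. down_block \<sigma> a d \<longleftrightarrow> inversions k \<subseteq> inversions \<sigma>"
        using down_block_iff_inversions[OF 3] by blast
      ultimately show ?thesis using glb glb' up[of a d] down[of a d] by simp
    qed
  qed
  then show ?thesis by (simp add: blocks_eq_iff)
qed

theorem theorem5p1:
  fixes n :: nat
  shows "lattice_congruence (permutohedron n)
    {(\<sigma>, \<nu>). \<sigma> \<in> \<SS> n \<and> \<nu> \<in> \<SS> n \<and> \<sigma> \<equiv>\<^sub>B \<nu>}"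
proof -
  interpret L: lattice "permutohedron n" by (rule lattice_permutohedron)
  let ?meet = "\<lambda>\<sigma> \<nu>. \<sigma> \<sqinter>\<^bsub>permutohedron n\<^esub> \<nu>"
  let ?join = "\<lambda>\<sigma> \<nu>. \<sigma> \<squnion>\<^bsub>permutohedron n\<^esub> \<nu>"
  have meet_in: "?meet \<sigma> \<nu> \<in> \<SS> n" and join_in: "?join \<sigma> \<nu> \<in> \<SS> n"
    if "\<sigma> \<in> \<SS> n" "\<nu> \<in> \<SS> n" for \<sigma> \<nu>
    using that L.meet_closed[of \<sigma> \<nu>] L.join_closed[of \<sigma> \<nu>] by auto
  have glb: "inversions j \<subseteq> inversions (?meet \<sigma> \<nu>) \<longleftrightarrow>
      inversions j \<subseteq> inversions \<sigma> \<and> inversions j \<subseteq> inversions \<nu>"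
    if "\<sigma> \<in> \<SS> n" "\<nu> \<in> \<SS> n" "j \<in> \<SS> n" for \<sigma> \<nu> j
    using that L.meet_left[of \<sigma> \<nu>] L.meet_right[of \<sigma> \<nu>] L.meet_le[of j \<sigma> \<nu>] meet_in[of \<sigma> \<nu>]
    by (auto simp: permutohedron_le_iff)
  have lub: "inversions (?join \<sigma> \<nu>) \<subseteq> inversions j \<longleftrightarrow>
      inversions \<sigma> \<subseteq> inversions j \<and> inversions \<nu> \<subseteq> inversions j"
    if "\<sigma> \<in> \<SS> n" "\<nu> \<in> \<SS> n" "j \<in> \<SS> n" for \<sigma> \<nu> j
    using that L.join_left[of \<sigma> \<nu>] L.join_right[of \<sigma> \<nu>] L.join_le[of \<sigma> j \<nu>] join_in[of \<sigma> \<nu>]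
    by (auto simp: permutohedron_le_iff)
  have anti: "inversions j \<subseteq> inversions (rev \<mu>) \<longleftrightarrow> inversions \<mu> \<subseteq> inversions (rev j)"
    if "\<mu> \<in> \<SS> n" "j \<in> \<SS> n" for \<mu> j
    using inversions_antimono_rev[of \<mu> n "rev j"] that by simp
  \<comment> \<open>The reversed join is the greatest lower bound of the reversed words.\<close>
  have glb_rev: "inversions j \<subseteq> inversions (rev (?join \<sigma> \<nu>)) \<longleftrightarrow>
      inversions j \<subseteq> inversions (rev \<sigma>) \<and> inversions j \<subseteq> inversions (rev \<nu>)"
    if "\<sigma> \<in> \<SS> n" "\<nu> \<in> \<SS> n" "j \<in> \<SS> n" for \<sigma> \<nu> j
    using anti[OF join_in[OF that(1,2)] that(3)] anti[OF that(1,3)] anti[OF that(2,3)]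
      lub[OF that(1,2), of "rev j"] that(3) by simp
  have rev_iff: "rev \<sigma> \<equiv>\<^sub>B rev \<nu> \<longleftrightarrow> \<sigma> \<equiv>\<^sub>B \<nu>" if "\<sigma> \<in> \<SS> n" "\<nu> \<in> \<SS> n" for \<sigma> \<nu>
    using baxter_rev[of \<sigma> \<nu>] baxter_rev[of "rev \<sigma>" "rev \<nu>"] that by (auto simp: symgroup_iff)
  have cong: "?meet x y \<equiv>\<^sub>B ?meet x' y' \<and> ?join x y \<equiv>\<^sub>B ?join x' y'"
    if "x \<in> \<SS> n" "x' \<in> \<SS> n" "y \<in> \<SS> n" "y' \<in> \<SS> n" "x \<equiv>\<^sub>B x'" "y \<equiv>\<^sub>B y'" for x x' y y'
  proof
    have "blocks (?meet x y) = blocks (?meet x' y')"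
    proof (rule blocks_cong_glb[OF that(1,3) meet_in[OF that(1,3)] that(2,4) meet_in[OF that(2,4)]])
      show "blocks x = blocks x'" "blocks y = blocks y'"
        using that by (simp_all flip: baxter_iff_blocks[of _ n])
    qed (fact glb[OF that(1,3)] glb[OF that(2,4)])+
    then show "?meet x y \<equiv>\<^sub>B ?meet x' y'"
      using that meet_in by (simp add: baxter_iff_blocks[of _ n])
    have r: "rev x \<in> \<SS> n" "rev x' \<in> \<SS> n" "rev y \<in> \<SS> n" "rev y' \<in> \<SS> n"
      "rev (?join x y) \<in> \<SS> n" "rev (?join x' y') \<in> \<SS> n"
      using that join_in by simp_all
    \<comment> \<open>Joins are handled through their reversals, to which
      \<open>blocks_cong_glb\<close> applies; \<open>rev_iff\<close> then transfers the result
      back.\<close>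
    have "blocks (rev (?join x y)) = blocks (rev (?join x' y'))"
    proof (rule blocks_cong_glb[OF r(1,3,5,2,4,6)])
      show "blocks (rev x) = blocks (rev x')" "blocks (rev y) = blocks (rev y')"
        using that r by (simp_all add: rev_iff flip: baxter_iff_blocks[of _ n])
    qed (fact glb_rev[OF that(1,3)] glb_rev[OF that(2,4)])+
    then have "rev (?join x y) \<equiv>\<^sub>B rev (?join x' y')"
      using r(5,6) by (simp add: baxter_iff_blocks[of _ n] del: rev_symgroup)
    then show "?join x y \<equiv>\<^sub>B ?join x' y'" using that join_in by (simp add: rev_iff)
  qed
  have "equiv (\<SS> n) {(\<sigma>, \<nu>). \<sigma> \<in> \<SS> n \<and> \<nu> \<in> \<SS> n \<and> \<sigma> \<equiv>\<^sub>B \<nu>}"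
    by (rule equivI)
      (auto intro!: refl_onI symI transI intro: baxter.refl baxter.sym baxter.trans)
  then show ?thesis
    using L.lattice_axioms cong meet_in join_in unfolding lattice_congruence_def by auto
qed

end
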